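(* Let $n \ge 5$ be an integer. Let $\mathcal{N}_{\max}$ be the maximum nullity among all quartic circulant graphs of order $n$, i.e. among the graphs $\mathrm{Circ}(n, \{p, q\})$ with integers $1 \le p < q < \frac{n}{2}$. Then the following hold. (1) If $n$ is odd, then $\mathcal{N}_{\max} = 0$; every $\mathrm{Circ}(n, \{p, q\})$ with $1 \le p < q < \frac{n}{2}$ attains it, and the corresponding null spaces are trivial. (2) If $n \ge 6$, $2 \mid n$ and $8 \nmid n$, then $\mathcal{N}_{\max} = \frac{n}{2}$; the graph $\mathrm{Circ}(n, \{p, q\})$, $1 \le p < q < \frac{n}{2}$, attains it if and only if $p + q = \frac{n}{2}$, and the null space of each such graph is \[ \left\{ (v_0, v_1, \ldots, v_{n-1})^{\mathrm T} \in \mathbb{R}^n \colon v_{j + \frac{n}{2}} = -v_j \ \text{ for all } 0 \le j \le \tfrac{n}{2}-1 \right\}. \] (3) If $n \ge 8$ and $8 \mid n$, then $\mathcal{N}_{\max} = \frac{3n}{4}$; the graph $\mathrm{Circ}(n, \{p, q\})$, $1 \le p < q < \frac{n}{2}$, attains it if and only if $p = \frac{n}{8}$ and $q = \frac{3n}{8}$, and the null space of this graph is \[ \left\{ (v_0, v_1, \ldots, v_{n-1})^{\mathrm T} \in \mathbb{R}^n \colon v_{j + \frac{3n}{4}} = -v_j - v_{j+\frac{n}{4}} - v_{j+\frac{n}{2}} \ \text{ for all } 0 \le j \le \tfrac{n}{4}-1 \right\}. \]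
   Context: For an integer $n \ge 1$ and a set $S$ of integers $j$ with $1 \le j \le \frac{n}{2}$, $\mathrm{Circ}(n, S)$ denotes the circulant graph with vertex set $\{0, 1, \ldots, n-1\}$ in which two distinct vertices $i, k$ are adjacent if and only if $i - k \equiv s$ or $i - k \equiv -s \pmod n$ for some $s \in S$. The quartic ($4$-regular) circulant graphs of order $n$ are exactly the graphs $\mathrm{Circ}(n, \{p, q\})$ with $n \ge 5$ and $1 \le p < q < \frac{n}{2}$. The null space of a graph is the null space of its adjacency matrix (as a subspace of $\mathbb{R}^n$, coordinates indexed by the vertices $0, 1, \ldots, n-1$ in order), and its nullity is the dimension of this null space. *)

theory Defs
  imports
    "HOL-Number_Theory.Cong"
    "Graph_Theory.Pair_Digraph"
    "Jordan_Normal_Form.Matrix_Kernel"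
begin

text \<open>
  An undirected simple graph is represented, as usual in the graph library, by its symmetric,
  loop-free arc relation (locale \<^locale>\<open>pair_graph\<close>): the edge \<open>{i, k}\<close> is the
  pair of arcs \<open>(i, k)\<close> and \<open>(k, i)\<close>.
\<close>

definition Circ :: "nat \<Rightarrow> nat set \<Rightarrow> nat pair_pre_digraph" where
  "Circ n S = \<lparr> pverts = {0..<n},
     parcs = {(i, k). i < n \<and> k < n \<and> i \<noteq> k \<and>
       (\<exists>s\<in>S. [int i - int k = int s] (mod int n) \<or> [int i - int k = - int s] (mod int n))} \<rparr>"

definition quartic_circulants :: "nat \<Rightarrow> nat pair_pre_digraph set" where
  "quartic_circulants n = {Circ n {p, q} | p q. 1 \<le> p \<and> p < q \<and> real q < real n / 2}"

text \<open>
  The following is meant for graphs whose vertex set is an initial segment of the natural numbers,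
  so that vertex \<open>i\<close> corresponds to row, column and coordinate \<open>i\<close>.
\<close>

definition adj_matrix :: "nat pair_pre_digraph \<Rightarrow> real mat" where
  "adj_matrix G = mat (card (pverts G)) (card (pverts G))
     (\<lambda>(i, k). if (i, k) \<in> parcs G then 1 else 0)"

definition null_space :: "nat pair_pre_digraph \<Rightarrow> real vec set" where
  "null_space G = mat_kernel (adj_matrix G)"

definition nullity :: "nat pair_pre_digraph \<Rightarrow> nat" where
  "nullity G = kernel_dim (adj_matrix G)"

definition max_nullity :: "nat \<Rightarrow> nat" where
  "max_nullity n = Max (nullity ` quartic_circulants n)"

lemma pair_graph_Circ: "pair_graph (Circ n S)"
proof
  show "finite (parcs (Circ n S))"
    by (rule finite_subset[of _ "{0..<n} \<times> {0..<n}"]) (auto simp: Circ_def)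
  have "(k, i) \<in> parcs (Circ n S)" if "(i, k) \<in> parcs (Circ n S)" for i k
  proof -
    have "[int k - int i = b] (mod int n) \<longleftrightarrow> [int i - int k = - b] (mod int n)" for b
      using cong_minus_minus_iff[of "int i - int k" "- b" "int n"] by simp
    with that show ?thesis
      unfolding Circ_def by auto
  qed
  then show "symmetric (with_proj (Circ n S))"
    by (auto simp: symmetric_def intro: symI)
qed (auto simp: Circ_def)

text \<open>The maximum defining \<^const>\<open>max_nullity\<close> is over a finite nonempty set.\<close>

lemma finite_quartic_circulants: "finite (quartic_circulants n)"
proof (rule finite_subset)
  show "quartic_circulants n \<subseteq> (\<lambda>(p, q). Circ n {p, q}) ` ({0..<n} \<times> {0..<n})"
    by (force simp: quartic_circulants_def)
qed simp

lemma quartic_circulants_nonempty: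
  assumes "n \<ge> 5"
  shows "quartic_circulants n \<noteq> {}"
proof -
  have "Circ n {1, 2} \<in> quartic_circulants n"
    unfolding quartic_circulants_def using assms
    by (intro CollectI exI[of _ 1] exI[of _ 2]) auto
  then show ?thesis by blast
qed

end

theory Submission
  imports Defs "HOL-Library.Periodic_Fun"
begin

text \<open>
  In terms of the cyclic shift \<open>X\<close>, the adjacency operator of \<open>Circ n {p, q}\<close> is
  \<open>X\<^sup>p + X\<^sup>-\<^sup>p + X\<^sup>q + X\<^sup>-\<^sup>q = X\<^sup>-\<^sup>q (X\<^sup>p\<^sup>+\<^sup>q + 1) (X\<^sup>q\<^sup>-\<^sup>p + 1)\<close>.
  The kernel of \<open>X\<^sup>a + 1\<close> consists of the \<open>a\<close>-antiperiodic vectors; with \<open>g = gcd a n\<close>, it is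
  trivial if \<open>n / g\<close> is odd, and has dimension \<open>g\<close> otherwise. Hence the nullity is at most the sum
  of these dimensions for \<open>a = p + q\<close> and \<open>a = q - p\<close>. As \<open>n / g\<close> must be even, \<open>g = n / 2\<close> is only
  possible for \<open>p + q = n / 2\<close>, and otherwise \<open>g \<le> n / 4\<close>, which yields the upper bounds. In the
  extremal cases the null space consists of the vectors all of whose sums over the cosets of
  \<open>\<langle>n / 2\<rangle>\<close> or \<open>\<langle>n / 4\<rangle>\<close> in \<open>\<int> / n\<close> vanish.
\<close>

section \<open>Kernel dimensions from coordinate maps\<close>

text \<open>An injective linear \<open>T\<close> carries a basis of the kernel to an independent
  set, and a bijective one is an isomorphism. Linearity is demanded only on the kernel, so any list
  of linear functionals can serve as \<open>T\<close>.\<close>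

lemma
  fixes A :: "'a :: field mat"
  assumes A: "A \<in> carrier_mat nr nc"
    and T: "\<And>v. v \<in> mat_kernel A \<Longrightarrow> T v \<in> carrier_vec m"
    and add: "\<And>v w. v \<in> mat_kernel A \<Longrightarrow> w \<in> mat_kernel A \<Longrightarrow> T (v + w) = T v + T w"
    and smult: "\<And>c v. v \<in> mat_kernel A \<Longrightarrow> T (c \<cdot>\<^sub>v v) = c \<cdot>\<^sub>v T v"
    and inj: "\<And>v. v \<in> mat_kernel A \<Longrightarrow> T v = 0\<^sub>v m \<Longrightarrow> v = 0\<^sub>v nc"
  shows kernel_dim_le: "kernel_dim A \<le> m"
    and kernel_dim_eq: "T ` mat_kernel A = carrier_vec m \<Longrightarrow> kernel_dim A = m"
proof -
  interpret kernel nr nc A by unfold_locales (rule A)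
  interpret W: vec_space "TYPE('a)" m .
  interpret lm: linear_map class_ring VK W.V T
    by unfold_locales (use T add smult in \<open>simp_all add: module_hom_def module_vec_simps\<close>)
  obtain B where finB: "finite B" and B: "basis B"
    using kernel_basis_exists[OF A] by blast
  have fd: "Ker.fin_dim"
    using finB B unfolding Ker.fin_dim_def Ker.basis_def by blast
  have "lm.kerT = {0\<^sub>v nc}"
    using inj lm.f0_is_0 by (auto simp: lm.ker_def)
  then have injT: "inj_on T (mat_kernel A)"
    using lm.Ke0_iff_inj by simp
  show "kernel_dim A = m" if "T ` mat_kernel A = carrier_vec m"
    using lm.dim_eq[OF fd] injT that by (simp add: W.dim_is_n)
  have BK: "B \<subseteq> mat_kernel A" and liB: "lin_indpt B"
    using B by (auto simp: Ker.basis_def)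
  have "W.lin_indpt (T ` B)"
  proof
    assume "W.lin_dep (T ` B)"
    then obtain C c w where C: "finite C" "C \<subseteq> T ` B" and c: "W.lincomb c C = 0\<^sub>v m"
      and w: "w \<in> C" "c w \<noteq> 0"
      by (auto simp: W.lin_dep_def)
    \<comment> \<open>\<open>D\<close> consists of preimages in \<open>B\<close>, so that a
      dependence among the images pulls back to one with coefficients
      \<open>c \<circ> T\<close>.\<close>
    from C obtain D where D: "finite D" "D \<subseteq> B" "C = T ` D"
      by (metis finite_subset_image)
    have DK: "D \<subseteq> mat_kernel A" using D BK by blast
    have "T (lincomb (c \<circ> T) D) = 0\<^sub>v m"
      using lm.lincomb_linear_image[OF _ _ _ D(1), of c] injT DK c D(3) by simp
    then have "lincomb (c \<circ> T) D = 0\<^sub>v nc"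
      by (intro inj) (use DK in auto)
    moreover obtain v where "v \<in> D" "(c \<circ> T) v \<noteq> 0"
      using w D(3) by auto
    ultimately have "lin_dep B"
      using D unfolding Ker.lin_dep_def by (auto intro!: exI[of _ D] exI[of _ "c \<circ> T"])
    with liB show False by simp
  qed
  moreover have "T ` B \<subseteq> carrier_vec m" using BK T by blast
  ultimately have "card (T ` B) \<le> m"
    using W.li_le_dim(2)[OF W.fin_dim] by (simp add: W.dim_is_n)
  moreover have "card (T ` B) = card B"
    using injT BK by (intro card_image) (rule inj_on_subset)
  moreover have "card B = kernel_dim A"
    using Ker.dim_basis[OF finB B] by simp
  ultimately show "kernel_dim A \<le> m" by simp
qed

text \<open>Here \<open>T\<close> is the projection to the first \<open>m\<close> coordinates, which
  are free parameters of the kernel.\<close>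

lemma kernel_dim_eq_take:
  fixes A :: "'a :: field mat"
  assumes A: "A \<in> carrier_mat nr nc" and m: "m \<le> nc"
    and inj: "\<And>v. v \<in> mat_kernel A \<Longrightarrow> (\<And>i. i < m \<Longrightarrow> v $ i = 0) \<Longrightarrow> v = 0\<^sub>v nc"
    and surj: "\<And>w :: 'a vec. \<exists>v \<in> mat_kernel A. \<forall>i < m. v $ i = w $ i"
  shows "kernel_dim A = m"
proof (rule kernel_dim_eq[OF A])
  have K: "v \<in> carrier_vec nc" if "v \<in> mat_kernel A" for v
    using mat_kernelD(1)[OF A that] .
  let ?T = "\<lambda>v :: 'a vec. vec m (($) v)"
  show "?T v \<in> carrier_vec m" for v by simp
  show "?T (v + w) = ?T v + ?T w" if "v \<in> mat_kernel A" "w \<in> mat_kernel A" for v w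
    using K[OF that(1)] K[OF that(2)] m by auto
  show "?T (c \<cdot>\<^sub>v v) = c \<cdot>\<^sub>v ?T v" if "v \<in> mat_kernel A" for c v
    using K[OF that] m by auto
  show "v = 0\<^sub>v nc" if "v \<in> mat_kernel A" "?T v = 0\<^sub>v m" for v
    using that(2) by (intro inj[OF that(1)]) (metis index_vec index_zero_vec(1))
  show "?T ` mat_kernel A = carrier_vec m"
  proof (intro equalityI subsetI)
    fix w :: "'a vec" assume w: "w \<in> carrier_vec m"
    from surj obtain v where "v \<in> mat_kernel A" "\<forall>i < m. v $ i = w $ i" by blast
    with w show "w \<in> ?T ` mat_kernel A" by (intro image_eqI[of _ _ v]) auto
  qed auto
qed

section \<open>Periodic extension and the adjacency operator\<close>

text \<open>\<open>cyc v\<close> extends the coordinates of \<open>v\<close> periodically to all integers, so that no index needs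
  to be reduced.\<close>

definition cyc :: "'a vec \<Rightarrow> int \<Rightarrow> 'a" where
  "cyc v i = v $ nat (i mod int (dim_vec v))"

lemma cyc_of_nat: "i < dim_vec v \<Longrightarrow> cyc v (int i) = v $ i"
  by (simp add: cyc_def)

lemma cyc_add_dim: "v \<in> carrier_vec n \<Longrightarrow> cyc v (i + int n) = cyc v i"
  by (auto simp: cyc_def)

lemma cyc_add:
  assumes "v \<in> carrier_vec n" "w \<in> carrier_vec n" "n > 0"
  shows "cyc (v + w) i = cyc v i + cyc w i"
proof -
  have "nat (i mod int n) < n" using assms(3) by (simp add: nat_less_iff)
  with assms show ?thesis by (simp add: cyc_def)
qed

lemma cyc_smult:
  assumes "v \<in> carrier_vec n" "n > 0"
  shows "cyc (c \<cdot>\<^sub>v v) i = c * cyc v i"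
proof -
  have "nat (i mod int n) < n" using assms(2) by (simp add: nat_less_iff)
  with assms show ?thesis by (simp add: cyc_def)
qed

lemma cyc_zero: "n > 0 \<Longrightarrow> cyc (0\<^sub>v n) i = 0"
  by (simp add: cyc_def nat_less_iff)

text \<open>The offsets \<open>p\<close>, \<open>-p\<close>, \<open>q\<close>, \<open>-q\<close> are
  nonzero and pairwise distinct modulo \<open>n\<close>, so row \<open>i\<close> contains exactly
  four ones.\<close>

lemma Circ_mult_vec:
  assumes pq: "1 \<le> p" "p < q" "2 * q < n" and v: "v \<in> carrier_vec n" and i: "i < n"
  shows "(adj_matrix (Circ n {p, q}) *\<^sub>v v) $ i =
    cyc v (int i + int p) + cyc v (int i - int p) + cyc v (int i + int q) + cyc v (int i - int q)"
proof -
  let ?S = "{int p, - int p, int q, - int q}" and ?f = "\<lambda>s. nat ((int i + s) mod int n)"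
  have eq_iff: "?f s = k \<longleftrightarrow> int n dvd int i + s - int k" if "k < n" for s k
  proof -
    have "?f s = k \<longleftrightarrow> (int i + s) mod int n = int k"
      using that by (simp add: nat_eq_iff)
    also have "\<dots> \<longleftrightarrow> (int i + s) mod int n = int k mod int n"
      using that by simp
    finally show ?thesis by (simp add: mod_eq_dvd_iff)
  qed
  have f_less: "?f s < n" for s using i by (simp add: nat_less_iff)
  have inj: "inj_on ?f ?S"
  proof (rule inj_onI)
    fix s t assume s: "s \<in> ?S" and t: "t \<in> ?S" and "?f s = ?f t"
    then have "int n dvd (int i + s) - (int i + t)"
      using i by (simp add: eq_nat_nat_iff mod_eq_dvd_iff)
    then have "int n dvd s - t" by simp
    \<comment> \<open>The largest difference is \<open>2 * q\<close>, between \<open>q\<close> and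
      \<open>-q\<close>; this is where \<open>q < n / 2\<close> enters.\<close>
    moreover have "\<bar>s - t\<bar> < int n" using s t pq by auto
    ultimately show "s = t" using dvd_imp_le_int[of "s - t" "int n"] by auto
  qed
  have nbhd: "{k \<in> {0..<n}. (i, k) \<in> parcs (Circ n {p, q})} = ?f ` ?S"
  proof (intro equalityI subsetI)
    fix k assume "k \<in> {k \<in> {0..<n}. (i, k) \<in> parcs (Circ n {p, q})}"
    then have k: "k < n" and "\<exists>s\<in>?S. int n dvd int i + s - int k"
      by (auto simp: Circ_def cong_iff_dvd_diff algebra_simps)
    then obtain s where s: "s \<in> ?S" "int n dvd int i + s - int k" by blast
    then have "k = ?f s" using eq_iff[OF k, of s] by simp
    with s(1) show "k \<in> ?f ` ?S" by (rule rev_image_eqI)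
  next
    fix k assume "k \<in> ?f ` ?S"
    then obtain s where s: "s \<in> ?S" "k = ?f s" by blast
    have k: "k < n" using f_less s(2) by simp
    have dvd: "int n dvd int i + s - int k" using eq_iff[OF k] s(2) by blast
    have "i \<noteq> k"
    proof
      assume "i = k"
      with dvd have "int n dvd s" by simp
      moreover have "s \<noteq> 0" "\<bar>s\<bar> < int n" using s(1) pq by auto
      ultimately show False using dvd_imp_le_int[of s "int n"] by auto
    qed
    moreover have "\<exists>t\<in>{p, q}. int n dvd int i - int k - int t \<or> int n dvd int i - int k + int t"
      using s(1) dvd by (auto simp: algebra_simps)
    ultimately show "k \<in> {k \<in> {0..<n}. (i, k) \<in> parcs (Circ n {p, q})}"
      using i k by (auto simp: Circ_def cong_iff_dvd_diff)
  qed
  have "(adj_matrix (Circ n {p, q}) *\<^sub>v v) $ i =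
      (\<Sum>k\<in>{0..<n}. (if (i, k) \<in> parcs (Circ n {p, q}) then 1 else 0) * v $ k)"
    using i v by (simp add: adj_matrix_def scalar_prod_def Circ_def)
  also have "\<dots> = (\<Sum>k\<in>{0..<n}. if (i, k) \<in> parcs (Circ n {p, q}) then v $ k else 0)"
    by (intro sum.cong) auto
  also have "\<dots> = (\<Sum>k\<in>?f ` ?S. v $ k)"
    unfolding nbhd[symmetric] by (rule sum.inter_filter[symmetric]) simp
  also have "\<dots> = (\<Sum>s\<in>?S. cyc v (int i + s))"
    using v by (subst sum.reindex[OF inj]) (simp add: cyc_def)
  also have "\<dots> = cyc v (int i + int p) + cyc v (int i - int p) + cyc v (int i + int q) + cyc v (int i - int q)"
    using pq by simp
  finally show ?thesis .
qed

lemma adj_matrix_Circ_carrier: "adj_matrix (Circ n S) \<in> carrier_mat n n"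
  by (simp add: adj_matrix_def Circ_def)

text \<open>This is the factored equation \<open>(X^(p+q) + 1) (X^(q-p) + 1) v = 0\<close>, written
  as antiperiodicity of \<open>(X^(q-p) + 1) v\<close> under the shift by
  \<open>p + q\<close>.\<close>

lemma null_space_Circ:
  assumes pq: "1 \<le> p" "p < q" "2 * q < n"
  shows "null_space (Circ n {p, q}) = {v \<in> carrier_vec n.
    \<forall>i. cyc v (i + int (p + q)) + cyc v (i + int (p + q) + int (q - p)) = - (cyc v i + cyc v (i + int (q - p)))}"
proof -
  have "adj_matrix (Circ n {p, q}) *\<^sub>v v = 0\<^sub>v n \<longleftrightarrow>
    (\<forall>i. cyc v (i + int (p + q)) + cyc v (i + int (p + q) + int (q - p)) = - (cyc v i + cyc v (i + int (q - p))))"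
    (is "?L \<longleftrightarrow> ?R") if v: "v \<in> carrier_vec n" for v
  proof -
    let ?g = "\<lambda>i. cyc v (i + int p) + cyc v (i - int p) + cyc v (i + int q) + cyc v (i - int q)"
    have per: "?g i = ?g (i mod int n)" for i
      using v by (simp add: cyc_def mod_simps)
    have "?L \<longleftrightarrow> (\<forall>i<n. ?g (int i) = 0)"
      using adj_matrix_Circ_carrier[of n "{p, q}"] v
      by (auto simp: vec_eq_iff Circ_mult_vec[OF pq v] simp del: index_mult_mat_vec)
    also have "\<dots> \<longleftrightarrow> (\<forall>i. ?g i = 0)"
    proof safe
      fix i assume *: "\<forall>i<n. ?g (int i) = 0"
      have "0 \<le> i mod int n" "nat (i mod int n) < n" using pq by (auto simp: nat_less_iff)
      with * show "?g i = 0" unfolding per[of i] by (metis int_nat_eq)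
    qed simp
    \<comment> \<open>Shifting by \<open>q\<close> turns the offsets into \<open>p + q\<close>,
      \<open>q - p\<close>, \<open>2 * q\<close> and \<open>0\<close>, where \<open>2 * q\<close> is
      \<open>(p + q) + (q - p)\<close>.\<close>
    also have "\<dots> \<longleftrightarrow> (\<forall>i. ?g (i + int q) = 0)"
      by (metis diff_add_cancel)
    also have "\<dots> \<longleftrightarrow> ?R"
      using pq by (intro all_cong1) (auto simp: algebra_simps)
    finally show ?thesis .
  qed
  then show ?thesis
    unfolding null_space_def mat_kernel[OF adj_matrix_Circ_carrier] by blast
qed

section \<open>Antiperiodic functions on a cyclic group\<close>

lemma periodic_int_mult:
  fixes f :: "int \<Rightarrow> 'a"
  assumes "\<And>i. f (i + d) = f i"
  shows "f (i + k * d) = f i"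
proof -
  interpret periodic_fun_simple f d by unfold_locales (rule assms)
  show ?thesis using plus_of_int[of i k] by simp
qed

lemma antiperiodic_mult:
  fixes H :: "int \<Rightarrow> real"
  assumes "\<And>i. H (i + a) = - H i"
  shows "H (i + int k * a) = (-1) ^ k * H i"
proof (induction k)
  case (Suc k)
  have "H (i + int (Suc k) * a) = H ((i + int k * a) + a)" by (simp add: algebra_simps)
  then show ?case using assms Suc by simp
qed simp

text \<open>The dimension of \<open>ker (X\<^sup>a + 1)\<close> on \<open>\<real>\<^sup>n\<close>.\<close>

definition antiperiodic_dim :: "nat \<Rightarrow> nat \<Rightarrow> nat" where
  "antiperiodic_dim n a = (if odd (n div gcd a n) then 0 else gcd a n)"

text \<open>Let \<open>g = gcd a n\<close> and \<open>c = n / g\<close>. Since \<open>c * a\<close>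
  is a multiple of \<open>n\<close>, shifting by it fixes \<open>H\<close>, but it also multiplies
  \<open>H\<close> by \<open>(-1)^c\<close>; so \<open>H = -H\<close> for odd \<open>c\<close>. For
  even \<open>c\<close>, \<open>g\<close> consecutive values determine \<open>H\<close> up to sign
  everywhere.\<close>

lemma antiperiodic_eq_0:
  fixes H :: "int \<Rightarrow> real"
  assumes n: "n > 0" and per: "\<And>i. H (i + int n) = H i" and anti: "\<And>i. H (i + int a) = - H i"
    and zero: "\<And>i. 0 \<le> i \<Longrightarrow> i < int (antiperiodic_dim n a) \<Longrightarrow> H i = 0"
  shows "H i = 0"
proof (cases "odd (n div gcd a n)")
  case True
  have "int (n div gcd a n) * int a = int (a div gcd a n) * int n"
    by (metis div_mult_swap dvd_div_mult gcd_dvd1 gcd_dvd2 mult.commute of_nat_mult)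
  then have "H i = H (i + int (n div gcd a n) * int a)"
    using periodic_int_mult[of H, OF per] by simp
  also have "\<dots> = - H i"
    using antiperiodic_mult[of H, OF anti] True by simp
  finally show ?thesis by simp
next
  case False
  define g where "g = int (gcd a n)"
  have g: "g > 0" using n by (simp add: g_def)
  obtain u v where uv: "u * int a + v * int n = g"
    using bezout_int[of "int a" "int n"] by (auto simp: g_def)
  \<comment> \<open>Absolute values make \<open>a\<close> a genuine period, so Bezout applies
    whatever the sign and parity of \<open>u\<close>.\<close>
  have "\<bar>H (i + g)\<bar> = \<bar>H i\<bar>" for i
  proof -
    have "H (i + g) = H ((i + u * int a) + v * int n)" by (simp flip: uv add: algebra_simps)
    also have "\<dots> = H (i + u * int a)" by (rule periodic_int_mult[of H, OF per])
    finally show ?thesis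
      using periodic_int_mult[of "\<lambda>i. \<bar>H i\<bar>" "int a" i u] anti by simp
  qed
  from periodic_int_mult[of "\<lambda>i. \<bar>H i\<bar>", OF this, of "i mod g" "i div g"]
  have "\<bar>H i\<bar> = \<bar>H (i mod g)\<bar>" by simp
  also have "H (i mod g) = 0"
    by (rule zero) (use g False in \<open>simp_all add: antiperiodic_dim_def g_def\<close>)
  finally show ?thesis by simp
qed

text \<open>A nonzero dimension \<open>g = gcd a n\<close> needs \<open>c = n / g\<close> even. If
  \<open>c = 2\<close>, then \<open>n / 2\<close> divides \<open>a < n\<close>, which forces the
  excluded \<open>a = n / 2\<close>. So \<open>c\<close> is 4 or at least 6.\<close>

lemma antiperiodic_dim_cases:
  assumes a: "0 < a" "a < n" "2 * a \<noteq> n"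
  shows "antiperiodic_dim n a = 0 \<or>
    n = 4 * antiperiodic_dim n a \<and> antiperiodic_dim n a dvd a \<or> 6 * antiperiodic_dim n a \<le> n"
proof (cases "odd (n div gcd a n)")
  case False
  define g c where "g = gcd a n" and "c = n div g"
  have n: "n = c * g" by (simp add: c_def g_def)
  have ga: "g dvd a" by (simp add: g_def)
  then obtain d where d: "a = g * d" by (elim dvdE)
  have "even c" using False by (simp add: c_def g_def)
  moreover have "c \<noteq> 0" using a n by (metis mult_0 not_less_zero)
  moreover have "c \<noteq> 2"
  proof
    assume "c = 2"
    with a n d have "d < 2" "d > 0" "d \<noteq> 1" by auto
    then show False by simp
  qed
  ultimately have "c = 4 \<or> c \<ge> 6" by presburger
  then show ?thesis
  proof
    assume "c = 4"
    then show ?thesis using n ga False by (auto simp: antiperiodic_dim_def g_def)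
  next
    assume "c \<ge> 6"
    then have "6 * g \<le> n" unfolding n by (rule mult_le_mono1)
    then show ?thesis by (simp add: antiperiodic_dim_def g_def)
  qed
qed (simp add: antiperiodic_dim_def)

lemma antiperiodic_dim_le: "a > 0 \<Longrightarrow> antiperiodic_dim n a \<le> a"
  by (simp add: antiperiodic_dim_def)

section \<open>Upper bounds for the nullity\<close>

text \<open>A vector \<open>v\<close> of the null space is recovered by first recovering \<open>(X\<^sup>q\<^sup>-\<^sup>p + 1) v\<close>, which is
  annihilated by \<open>X\<^sup>p\<^sup>+\<^sup>q + 1\<close>.\<close>

lemma null_space_Circ_eq_0:
  assumes pq: "1 \<le> p" "p < q" "2 * q < n" and vn: "v \<in> null_space (Circ n {p, q})"
    and z1: "\<And>i. 0 \<le> i \<Longrightarrow> i < int (antiperiodic_dim n (q - p)) \<Longrightarrow> cyc v i = 0"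
    and z2: "\<And>i. 0 \<le> i \<Longrightarrow> i < int (antiperiodic_dim n (p + q)) \<Longrightarrow> cyc v i + cyc v (i + int (q - p)) = 0"
  shows "v = 0\<^sub>v n"
proof -
  have n: "n > 0" using pq by simp
  have v: "v \<in> carrier_vec n" using vn null_space_Circ[OF pq] by simp
  let ?H = "\<lambda>i. cyc v i + cyc v (i + int (q - p))"
  have "?H i = 0" for i
  proof (rule antiperiodic_eq_0[OF n, of ?H "p + q"])
    show "?H (i + int n) = ?H i" for i
      using cyc_add_dim[OF v, of i] cyc_add_dim[OF v, of "i + int (q - p)"] by (simp add: algebra_simps)
    show "?H (i + int (p + q)) = - ?H i" for i
      using vn null_space_Circ[OF pq] by auto
  qed (rule z2)
  then have neg: "cyc v (i + int (q - p)) = - cyc v i" for i by (simp add: add_eq_0_iff)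
  have "cyc v i = 0" for i
    by (rule antiperiodic_eq_0[OF n, of "cyc v" "q - p"]) (use cyc_add_dim[OF v] neg z1 in auto)
  then have "v $ i = 0" if "i < n" for i
    using that v by (metis cyc_of_nat carrier_vecD)
  then show ?thesis using v by (intro eq_vecI) auto
qed

lemma nullity_le:
  assumes pq: "1 \<le> p" "p < q" "2 * q < n"
  shows "nullity (Circ n {p, q}) \<le> antiperiodic_dim n (p + q) + antiperiodic_dim n (q - p)"
proof -
  let ?A = "adj_matrix (Circ n {p, q})"
  define d e where "d = antiperiodic_dim n (q - p)" and "e = antiperiodic_dim n (p + q)"
  \<comment> \<open>\<open>T\<close> lists the \<open>d\<close> values of \<open>v\<close> and the
    \<open>e\<close> values of \<open>(X^(q-p) + 1) v\<close> whose vanishing forces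
    \<open>v = 0\<close>.\<close>
  define T :: "real vec \<Rightarrow> real vec" where
    "T v = vec (d + e) (\<lambda>i. if i < d then cyc v (int i)
      else cyc v (int (i - d)) + cyc v (int (i - d) + int (q - p)))" for v
  have n: "n > 0" using pq by simp
  have K: "v \<in> carrier_vec n" if "v \<in> mat_kernel ?A" for v
    using mat_kernelD(1)[OF adj_matrix_Circ_carrier that] .
  have "kernel_dim ?A \<le> d + e"
  proof (rule kernel_dim_le[OF adj_matrix_Circ_carrier, where T = T])
    show "T v \<in> carrier_vec (d + e)" for v by (simp add: T_def)
    show "T (v + w) = T v + T w" if "v \<in> mat_kernel ?A" "w \<in> mat_kernel ?A" for v w
      using K[OF that(1)] K[OF that(2)] n by (auto simp: T_def cyc_add)
    show "T (c \<cdot>\<^sub>v v) = c \<cdot>\<^sub>v T v" if "v \<in> mat_kernel ?A" for c v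
      using K[OF that] n by (auto simp: T_def cyc_smult algebra_simps)
    show "v = 0\<^sub>v n" if vk: "v \<in> mat_kernel ?A" and T0: "T v = 0\<^sub>v (d + e)" for v
    proof (rule null_space_Circ_eq_0[OF pq])
      show "v \<in> null_space (Circ n {p, q})" using vk by (simp add: null_space_def)
      have T: "T v $ i = 0" if "i < d + e" for i
        using T0 that by simp
      show "cyc v i = 0" if "0 \<le> i" "i < int (antiperiodic_dim n (q - p))" for i
      proof -
        have "nat i < d" using that by (simp add: d_def nat_less_iff)
        with T[of "nat i"] that(1) show ?thesis by (simp add: T_def)
      qed
      show "cyc v i + cyc v (i + int (q - p)) = 0"
        if "0 \<le> i" "i < int (antiperiodic_dim n (p + q))" for i
      proof -
        have "nat i < e" using that by (simp add: e_def nat_less_iff)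
        with T[of "d + nat i"] that(1) show ?thesis by (simp add: T_def)
      qed
    qed
  qed
  then show ?thesis by (simp add: nullity_def d_def e_def)
qed

text \<open>Both antiperiodic dimensions are at most \<open>n / 4\<close>, so only the case that
  both equal \<open>n / 4\<close> has to be excluded.\<close>

lemma nullity_less_half:
  assumes pq: "1 \<le> p" "p < q" "2 * q < n" and half: "2 * (p + q) \<noteq> n"
  shows "2 * nullity (Circ n {p, q}) < n"
proof -
  let ?a = "antiperiodic_dim n (p + q)" and ?b = "antiperiodic_dim n (q - p)"
  have ca: "?a = 0 \<or> n = 4 * ?a \<and> ?a dvd p + q \<or> 6 * ?a \<le> n"
    using pq half by (intro antiperiodic_dim_cases) auto
  have cb: "?b = 0 \<or> n = 4 * ?b \<and> ?b dvd q - p \<or> 6 * ?b \<le> n"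
    using pq by (intro antiperiodic_dim_cases) auto
  have "\<not> (n = 4 * ?a \<and> n = 4 * ?b)"
  proof (intro notI, elim conjE)
    assume n: "n = 4 * ?a" "n = 4 * ?b"
    then have dvd: "?a dvd p + q" "?b dvd q - p" using ca cb pq by auto
    define g where "g = ?a"
    have ng: "n = 4 * g" "?b = g" using n by (auto simp: g_def)
    obtain k l where k: "p + q = g * k" and l: "q - p = g * l"
      using dvd ng by (metis dvd_def g_def)
    have "g > 0" using pq ng by simp
    \<comment> \<open>In units of \<open>g = n / 4\<close>, the bounds leave only
      \<open>q - p = g\<close> and \<open>p + q = 3 * g\<close>, and adding these gives
      \<open>2 * q = n\<close>.\<close>
    have "g * l < g * 2" "g * l > 0" "g * k < g * 4" "g * l < g * k"
      using k l pq ng by linarith+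
    moreover have "k \<noteq> 2" using k ng half by auto
    ultimately have "l = 1" "k = 3" by auto
    then have "2 * q = n" using k l ng pq by simp
    then show False using pq by simp
  qed
  moreover have "4 * ?a \<le> n" "4 * ?b \<le> n" using ca cb by auto
  moreover have "2 * (a + b) < n" if "\<not> (n = 4 * a \<and> n = 4 * b)" "4 * a \<le> n" "4 * b \<le> n" for a b
    using that by auto
  ultimately have "2 * (?a + ?b) < n" by blast
  with mult_le_mono2[OF nullity_le[OF pq], of 2] show ?thesis by (rule le_less_trans)
qed

section \<open>Vectors with vanishing coset sums\<close>

text \<open>Moving the base point by \<open>m\<close> permutes the terms of a coset sum cyclically,
  so base points below \<open>m\<close> represent all cosets.\<close>

lemma cyc_coset_sums:
  fixes v :: "real vec"
  assumes v: "v \<in> carrier_vec (c * m)" and m: "m > 0"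
  shows "(\<forall>j<m. (\<Sum>k<c. v $ (j + k * m)) = 0) \<longleftrightarrow> (\<forall>i. (\<Sum>k<c. cyc v (i + int (k * m))) = 0)"
proof -
  let ?G = "\<lambda>i. \<Sum>k<c. cyc v (i + int (k * m))"
  have per: "?G (i + int m) = ?G i" for i
  proof -
    let ?f = "\<lambda>k. cyc v (i + int (k * m))"
    \<comment> \<open>The sum of \<open>c + 1\<close> consecutive terms is split off at either end;
      the two end terms agree because \<open>c * m\<close> is the period.\<close>
    have "?f 0 + (\<Sum>k<c. ?f (Suc k)) = (\<Sum>k<c. ?f k) + ?f c"
      using sum.lessThan_Suc_shift[of ?f c] sum.lessThan_Suc[of ?f c] by simp
    moreover have "?f c = ?f 0" using cyc_add_dim[OF v, of i] by simp
    ultimately show ?thesis by (simp add: algebra_simps)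
  qed
  have G_nat: "?G (int j) = (\<Sum>k<c. v $ (j + k * m))" if "j < m" for j
  proof (intro sum.cong refl)
    fix k assume "k \<in> {..<c}"
    then have "j + k * m < Suc k * m" "Suc k * m \<le> c * m"
      using that mult_le_mono1[of "Suc k" c m] by auto
    then have "j + k * m < dim_vec v" using v by auto
    then show "cyc v (int j + int (k * m)) = v $ (j + k * m)"
      by (metis cyc_of_nat of_nat_add)
  qed
  have "(\<forall>j<m. ?G (int j) = 0) \<longleftrightarrow> (\<forall>i. ?G i = 0)"
  proof safe
    fix i assume *: "\<forall>j<m. ?G (int j) = 0"
    have "0 \<le> i mod int m" "nat (i mod int m) < m" using m by (auto simp: nat_less_iff)
    with * have "?G (i mod int m) = 0" by (metis int_nat_eq)
    then show "?G i = 0"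
      using periodic_int_mult[of ?G, OF per, of "i mod int m" "i div int m"] by simp
  qed simp
  then show ?thesis using G_nat by simp
qed

text \<open>The \<open>m\<close> constraints involve disjoint sets of coordinates, and each one
  determines its coordinate in the last block of length \<open>m\<close> from the preceding
  blocks.\<close>

lemma kernel_dim_coset_sums:
  fixes A :: "real mat"
  assumes A: "A \<in> carrier_mat nr (c * m)" and c: "c > 0"
    and ker: "mat_kernel A = {v \<in> carrier_vec (c * m). \<forall>j<m. (\<Sum>k<c. v $ (j + k * m)) = 0}"
  shows "kernel_dim A = (c - 1) * m"
proof -
  obtain d where d: "c = Suc d" using c by (cases c) auto
  note A = A[unfolded d] and ker = ker[unfolded d]
  have "kernel_dim A = d * m"
  proof (rule kernel_dim_eq_take[OF A])
    have less: "j + k * m < d * m" if "j < m" "k < d" for j k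
    proof -
      have "j + k * m < Suc k * m" using that by simp
      also have "\<dots> \<le> d * m" using that by (intro mult_le_mono1) simp
      finally show ?thesis .
    qed
    show "d * m \<le> Suc d * m" by simp
    show "v = 0\<^sub>v (Suc d * m)" if vk: "v \<in> mat_kernel A" and z: "\<And>i. i < d * m \<Longrightarrow> v $ i = 0" for v
    proof (rule eq_vecI)
      fix i assume "i < dim_vec (0\<^sub>v (Suc d * m))"
      then have i: "i < Suc d * m" by simp
      show "v $ i = 0\<^sub>v (Suc d * m) $ i"
      proof (cases "i < d * m")
        case False
        define j where "j = i - d * m"
        have j: "j < m" "i = j + d * m" using False i by (auto simp: j_def)
        have "(\<Sum>k<d. v $ (j + k * m)) = 0"
          using z less j by (intro sum.neutral) simp
        moreover have "(\<Sum>k<Suc d. v $ (j + k * m)) = 0" using vk j(1) unfolding ker by blast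
        ultimately show ?thesis using i j by simp
      qed (use z i in simp)
    qed (use vk ker in simp)
    show "\<exists>v \<in> mat_kernel A. \<forall>i < d * m. v $ i = w $ i" for w :: "real vec"
    proof
      \<comment> \<open>The free coordinates come from \<open>w\<close>; each entry of the last
        block is minus the rest of its coset sum.\<close>
      let ?v = "vec (Suc d * m) (\<lambda>i. if i < d * m then w $ i else - (\<Sum>k<d. w $ (i - d * m + k * m)))"
      have "(\<Sum>k<Suc d. ?v $ (j + k * m)) = 0" if j: "j < m" for j
      proof -
        have "?v $ (j + k * m) = w $ (j + k * m)" if "k < d" for k
          using less[OF j that] by simp
        then have "(\<Sum>k<d. ?v $ (j + k * m)) = (\<Sum>k<d. w $ (j + k * m))"
          by (intro sum.cong) auto
        then show ?thesis using j by simp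
      qed
      then show "?v \<in> mat_kernel A" unfolding ker by simp
      show "\<forall>i < d * m. ?v $ i = w $ i" by simp
    qed
  qed
  then show ?thesis by (simp add: d)
qed

section \<open>The maximum, and odd order\<close>

lemma max_nullity_eqI:
  assumes le: "\<And>p q. 1 \<le> p \<Longrightarrow> p < q \<Longrightarrow> 2 * q < n \<Longrightarrow> nullity (Circ n {p, q}) \<le> M"
    and attained: "1 \<le> p" "p < q" "2 * q < n" "nullity (Circ n {p, q}) = M"
  shows "max_nullity n = M"
  unfolding max_nullity_def
proof (rule Max_eqI)
  have iff: "real q < real n / 2 \<longleftrightarrow> 2 * q < n" for q by linarith
  show "finite (nullity ` quartic_circulants n)" using finite_quartic_circulants by simp
  show "x \<le> M" if "x \<in> nullity ` quartic_circulants n" for x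
    using that le by (auto simp: quartic_circulants_def iff)
  have "Circ n {p, q} \<in> quartic_circulants n"
    using attained unfolding quartic_circulants_def iff by blast
  then show "M \<in> nullity ` quartic_circulants n" using attained(4) by blast
qed

text \<open>Every \<open>n / gcd a n\<close> divides the odd number \<open>n\<close>, so both
  factors \<open>X^(p+q) + 1\<close> and \<open>X^(q-p) + 1\<close> are injective.\<close>

lemma nullity_odd:
  assumes "odd n" and pq: "1 \<le> p" "p < q" "2 * q < n"
  shows "nullity (Circ n {p, q}) = 0" and "null_space (Circ n {p, q}) = {0\<^sub>v n}"
proof -
  have "odd (n div gcd a n)" for a
    using \<open>odd n\<close> by (metis dvd_div_mult_self dvd_mult gcd_dvd2 mult.commute)
  then have dim: "antiperiodic_dim n a = 0" for a by (simp add: antiperiodic_dim_def)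
  then show "nullity (Circ n {p, q}) = 0" using nullity_le[OF pq] by simp
  show "null_space (Circ n {p, q}) = {0\<^sub>v n}"
  proof (intro equalityI subsetI)
    fix v assume "v \<in> null_space (Circ n {p, q})"
    then have "v = 0\<^sub>v n" by (rule null_space_Circ_eq_0[OF pq]) (simp_all add: dim)
    then show "v \<in> {0\<^sub>v n}" by simp
  qed (use pq in \<open>simp add: null_space_Circ cyc_zero\<close>)
qed

section \<open>Even order not divisible by 8\<close>

text \<open>If \<open>m / g\<close> were even, so would be \<open>m\<close>, hence \<open>b\<close>
  and \<open>g = gcd b m\<close>, giving \<open>4 dvd m\<close>. This serves
  \<open>b = q - p\<close> with \<open>p + q = m\<close>, where the parities agree.\<close>

lemma antiperiodic_dim_half_eq_0:
  assumes m: "m > 0" "\<not> 4 dvd m" and par: "even b \<longleftrightarrow> even m"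
  shows "antiperiodic_dim m b = 0"
proof -
  define g where "g = gcd b m"
  define c where "c = m div g"
  have mg: "m = g * c" by (simp add: c_def g_def)
  have "odd c"
  proof
    assume c: "even c"
    then have "even m" using mg by simp
    then have "even g" using par by (simp add: g_def)
    with c have "2 * 2 dvd g * c" by (intro mult_dvd_mono)
    with mg m show False by simp
  qed
  then show ?thesis by (simp add: antiperiodic_dim_def c_def g_def)
qed

text \<open>As \<open>n = 2 * m\<close>, the vector \<open>W = (X^m + 1) v\<close> is
  \<open>m\<close>-periodic. The null space equation makes \<open>W\<close> antiperiodic under
  \<open>q - p\<close>, and modulo \<open>m\<close> this forces \<open>W = 0\<close>.\<close>

lemma null_space_half:
  assumes n: "n = 2 * m" "\<not> 4 dvd m" and pq: "1 \<le> p" "p < q" "2 * q < n" and half: "p + q = m"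
  shows "null_space (Circ n {p, q}) = {v \<in> carrier_vec n. \<forall>j<m. (\<Sum>k<2. v $ (j + k * m)) = 0}"
proof -
  have m: "m > 0" using pq n by simp
  let ?b = "int (q - p)"
  have "(\<forall>i. cyc v (i + int (p + q)) + cyc v (i + int (p + q) + ?b) = - (cyc v i + cyc v (i + ?b))) \<longleftrightarrow>
      (\<forall>j<m. (\<Sum>k<2. v $ (j + k * m)) = 0)" (is "?L \<longleftrightarrow> ?R") if v: "v \<in> carrier_vec n" for v :: "real vec"
  proof -
    let ?W = "\<lambda>i. cyc v i + cyc v (i + int m)"
    have "?R \<longleftrightarrow> (\<forall>i. ?W i = 0)"
      using cyc_coset_sums[of v 2 m] v n m by (simp add: numeral_2_eq_2)
    also have "\<dots> \<longleftrightarrow> ?L"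
    proof
      assume W: "\<forall>i. ?W i = 0"
      have "cyc v (i + int m) + cyc v (i + int m + ?b) = - (cyc v i + cyc v (i + ?b))" for i
        using W[rule_format, of i] W[rule_format, of "i + ?b"] by (simp add: algebra_simps)
      then show ?L using half by simp
    next
      assume L: ?L
      show "\<forall>i. ?W i = 0"
      proof
        fix i
        show "?W i = 0"
        proof (rule antiperiodic_eq_0[OF m, of ?W "q - p"])
          show "?W (i + int m) = ?W i" for i
            using cyc_add_dim[OF v, of i] n by (simp add: algebra_simps)
          \<comment> \<open>The same four terms are regrouped, exchanging the roles of the two
            commuting factors.\<close>
          show "?W (i + ?b) = - ?W i" for i
            using L[rule_format, of i] half by (simp add: algebra_simps)
          have "even (q - p) \<longleftrightarrow> even m" using pq half by auto
          then show "?W i = 0" if "0 \<le> i" "i < int (antiperiodic_dim m (q - p))" for i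
            using antiperiodic_dim_half_eq_0[OF m n(2)] that by simp
        qed
      qed
    qed
    finally show ?thesis by simp
  qed
  then show ?thesis unfolding null_space_Circ[OF pq] by blast
qed

lemma nullity_half:
  assumes n: "n = 2 * m" "\<not> 4 dvd m" and pq: "1 \<le> p" "p < q" "2 * q < n" and half: "p + q = m"
  shows "nullity (Circ n {p, q}) = m"
proof -
  have "kernel_dim (adj_matrix (Circ n {p, q})) = (2 - 1) * m"
    by (rule kernel_dim_coset_sums[of _ n])
      (use adj_matrix_Circ_carrier[of n "{p, q}"] null_space_half[OF assms] n(1)
        in \<open>simp_all only: null_space_def zero_less_numeral\<close>)
  then show ?thesis by (simp add: nullity_def)
qed

section \<open>Order divisible by 8\<close>

text \<open>Here \<open>p + q = 4 * r\<close> and \<open>q - p = 2 * r\<close>, and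
  \<open>(X^(4r) + 1) (X^(2r) + 1)\<close> expands to \<open>1 + X^(2r) + X^(4r) + X^(6r)\<close>,
  the sum over a coset of the multiples of \<open>n / 4\<close>.\<close>

lemma null_space_three_quarters:
  assumes n: "n = 8 * r" and r: "r > 0"
  shows "null_space (Circ n {r, 3 * r}) =
    {v \<in> carrier_vec n. \<forall>j<2 * r. (\<Sum>k<4. v $ (j + k * (2 * r))) = 0}"
proof -
  have pq: "1 \<le> r" "r < 3 * r" "2 * (3 * r) < n" using n r by auto
  have "(\<forall>j<2 * r. (\<Sum>k<4. v $ (j + k * (2 * r))) = 0) \<longleftrightarrow>
    (\<forall>i. cyc v (i + int (r + 3 * r)) + cyc v (i + int (r + 3 * r) + int (3 * r - r)) =
      - (cyc v i + cyc v (i + int (3 * r - r))))"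
    if v: "v \<in> carrier_vec n" for v :: "real vec"
  proof -
    have v': "v \<in> carrier_vec (4 * (2 * r))" and r2: "2 * r > 0" using v n r by simp_all
    have "(\<Sum>k<4. cyc v (i + int (k * (2 * r)))) = (cyc v i + cyc v (i + int (3 * r - r))) +
        (cyc v (i + int (r + 3 * r)) + cyc v (i + int (r + 3 * r) + int (3 * r - r)))" for i
      by (simp add: eval_nat_numeral algebra_simps)
    then show ?thesis unfolding cyc_coset_sums[OF v' r2] by (simp only: add_eq_0_iff)
  qed
  then show ?thesis unfolding null_space_Circ[OF pq] by blast
qed

lemma nullity_three_quarters:
  assumes n: "n = 8 * r" and r: "r > 0"
  shows "nullity (Circ n {r, 3 * r}) = 6 * r"
proof -
  have n4: "n = 4 * (2 * r)" using n by simp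
  have "kernel_dim (adj_matrix (Circ n {r, 3 * r})) = (4 - 1) * (2 * r)"
    by (rule kernel_dim_coset_sums[of _ n])
      (use adj_matrix_Circ_carrier[of n "{r, 3 * r}"] null_space_three_quarters[OF assms]
        in \<open>simp_all only: null_space_def zero_less_numeral flip: n4\<close>)
  then show ?thesis by (simp add: nullity_def)
qed

text \<open>Unless \<open>p + q = n / 2\<close>, the nullity is below \<open>n / 2\<close>. If
  \<open>p + q = n / 2\<close>, a dimension \<open>n / 4\<close> for \<open>q - p\<close> would
  force \<open>q - p = n / 4\<close>, the excluded pair; otherwise the total is at most
  \<open>n / 2 + n / 6\<close>, which is below \<open>3 * n / 4\<close>.\<close>

lemma nullity_less_three_quarters:
  assumes n: "n = 8 * r" and pq: "1 \<le> p" "p < q" "2 * q < n" and neq: "\<not> (p = r \<and> q = 3 * r)"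
  shows "nullity (Circ n {p, q}) < 6 * r"
proof (cases "2 * (p + q) = n")
  case False
  then show ?thesis using nullity_less_half[OF pq] n by linarith
next
  case True
  let ?b = "antiperiodic_dim n (q - p)"
  have b: "?b = 0 \<or> n = 4 * ?b \<and> ?b dvd q - p \<or> 6 * ?b \<le> n"
    using pq by (intro antiperiodic_dim_cases) auto
  have "n \<noteq> 4 * ?b"
  proof
    assume n4: "n = 4 * ?b"
    then have "?b dvd q - p" using b pq by auto
    then obtain l where l: "q - p = 2 * r * l" using n n4 by auto
    \<comment> \<open>The first bound is \<open>q - p < p + q = 4 * r\<close>.\<close>
    have "2 * r * l < 2 * r * 2" "2 * r * l > 0" using l pq True n by linarith+
    then have "l = 1" by auto
    then show False using neq l True n by simp
  qed
  then have "6 * ?b \<le> n" using b by auto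
  moreover have "2 * antiperiodic_dim n (p + q) \<le> n"
    using True pq antiperiodic_dim_le[of "p + q" n] by simp
  moreover have "k < 6 * r" if "6 * b \<le> n" "2 * a \<le> n" "k \<le> a + b" for a b k
    using that n pq by linarith
  ultimately show ?thesis using nullity_le[OF pq] by blast
qed

theorem theorem13:
  fixes n :: nat
  assumes "n \<ge> 5"
  shows
    "(odd n \<longrightarrow>
        max_nullity n = 0 \<and>
        (\<forall>p q. 1 \<le> p \<and> p < q \<and> real q < real n / 2 \<longrightarrow>
          nullity (Circ n {p, q}) = max_nullity n \<and>
          null_space (Circ n {p, q}) = {0\<^sub>v n})) \<and>
     (n \<ge> 6 \<and> 2 dvd n \<and> \<not> 8 dvd n \<longrightarrow>
        real (max_nullity n) = real n / 2 \<and>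
        (\<forall>p q. 1 \<le> p \<and> p < q \<and> real q < real n / 2 \<longrightarrow>
          (nullity (Circ n {p, q}) = max_nullity n \<longleftrightarrow> real (p + q) = real n / 2) \<and>
          (real (p + q) = real n / 2 \<longrightarrow>
            null_space (Circ n {p, q}) =
              {v \<in> carrier_vec n. \<forall>j < n div 2. v $ (j + n div 2) = - v $ j}))) \<and>
     (n \<ge> 8 \<and> 8 dvd n \<longrightarrow>
        real (max_nullity n) = 3 * real n / 4 \<and>
        (\<forall>p q. 1 \<le> p \<and> p < q \<and> real q < real n / 2 \<longrightarrow>
          (nullity (Circ n {p, q}) = max_nullity n \<longleftrightarrow>
            real p = real n / 8 \<and> real q = 3 * real n / 8)) \<and>
        null_space (Circ n {n div 8, 3 * n div 8}) =
          {v \<in> carrier_vec n. \<forall>j < n div 4.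
             v $ (j + 3 * n div 4) = - v $ j - v $ (j + n div 4) - v $ (j + n div 2)})"
proof (intro conjI impI)
  have q_iff: "real q < real n / 2 \<longleftrightarrow> 2 * q < n" for q by linarith
  {
    assume odd: "odd n"
    show max: "max_nullity n = 0"
      by (rule max_nullity_eqI[of _ _ 1 2]) (use odd assms nullity_odd(1) in auto)
    show "\<forall>p q. 1 \<le> p \<and> p < q \<and> real q < real n / 2 \<longrightarrow>
        nullity (Circ n {p, q}) = max_nullity n \<and> null_space (Circ n {p, q}) = {0\<^sub>v n}"
      unfolding max q_iff using nullity_odd[OF odd] by blast
  }
  {
    assume n: "n \<ge> 6 \<and> 2 dvd n \<and> \<not> 8 dvd n"
    then obtain m where m: "n = 2 * m" by auto
    have m4: "\<not> 4 dvd m" using n m by auto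
    have le: "nullity (Circ n {p, q}) \<le> m" if "1 \<le> p" "p < q" "2 * q < n" for p q
      using nullity_less_half[OF that] nullity_half[OF m m4 that] m
      by (cases "p + q = m") auto
    \<comment> \<open>The pair \<open>1\<close>, \<open>m - 1\<close> sums to \<open>n / 2\<close>;
      \<open>n \<ge> 6\<close> ensures \<open>1 < m - 1\<close>.\<close>
    have "nullity (Circ n {1, m - 1}) = m"
      by (rule nullity_half[OF m m4]) (use n m in auto)
    then have max: "max_nullity n = m"
      by (intro max_nullity_eqI[of n m 1 "m - 1"] le) (use n m in auto)
    then show "real (max_nullity n) = real n / 2" using m by simp
    have half_iff: "real (p + q) = real n / 2 \<longleftrightarrow> p + q = m" for p q using m by auto
    show "\<forall>p q. 1 \<le> p \<and> p < q \<and> real q < real n / 2 \<longrightarrow>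
          (nullity (Circ n {p, q}) = max_nullity n \<longleftrightarrow> real (p + q) = real n / 2) \<and>
          (real (p + q) = real n / 2 \<longrightarrow>
            null_space (Circ n {p, q}) =
              {v \<in> carrier_vec n. \<forall>j < n div 2. v $ (j + n div 2) = - v $ j})"
      unfolding max q_iff half_iff
    proof (intro allI impI conjI; elim conjE)
      fix p q assume pq: "1 \<le> p" "p < q" "2 * q < n"
      show "nullity (Circ n {p, q}) = m \<longleftrightarrow> p + q = m"
        using nullity_less_half[OF pq] nullity_half[OF m m4 pq] m by (cases "p + q = m") auto
      assume half: "p + q = m"
      show "null_space (Circ n {p, q}) =
          {v \<in> carrier_vec n. \<forall>j < n div 2. v $ (j + n div 2) = - v $ j}"
      proof -
        have "(\<Sum>k<2. v $ (j + k * m)) = 0 \<longleftrightarrow> v $ (j + m) = - v $ j" for v :: "real vec" and j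
          by (simp add: numeral_2_eq_2 add_eq_0_iff)
        moreover have "n div 2 = m" using m by simp
        ultimately show ?thesis using null_space_half[OF m m4 pq half] by simp
      qed
    qed
  }
  {
    assume n: "n \<ge> 8 \<and> 8 dvd n"
    then obtain r where r: "n = 8 * r" by auto
    have r0: "r > 0" using n r by simp
    have le: "nullity (Circ n {p, q}) \<le> 6 * r" if "1 \<le> p" "p < q" "2 * q < n" for p q
      using nullity_less_three_quarters[OF r that] nullity_three_quarters[OF r r0] by force
    have max: "max_nullity n = 6 * r"
      by (intro max_nullity_eqI[of n "6 * r" r "3 * r"] le nullity_three_quarters[OF r r0])
        (use r r0 in auto)
    then show "real (max_nullity n) = 3 * real n / 4" using r by simp
    have eq_iff: "real p = real n / 8 \<and> real q = 3 * real n / 8 \<longleftrightarrow> p = r \<and> q = 3 * r" for p q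
      using r by auto
    show "\<forall>p q. 1 \<le> p \<and> p < q \<and> real q < real n / 2 \<longrightarrow>
          (nullity (Circ n {p, q}) = max_nullity n \<longleftrightarrow>
            real p = real n / 8 \<and> real q = 3 * real n / 8)"
      unfolding max q_iff eq_iff
      using nullity_less_three_quarters[OF r] nullity_three_quarters[OF r r0] by (metis less_irrefl)
    \<comment> \<open>\<open>3 * n div 8\<close> parses as \<open>(3 * n) div 8\<close>; all these
      divisions are exact.\<close>
    have div: "n div 8 = r" "3 * n div 8 = 3 * r" "n div 4 = 2 * r" "3 * n div 4 = 6 * r"
      "n div 2 = 4 * r" using r by auto
    show "null_space (Circ n {n div 8, 3 * n div 8}) =
          {v \<in> carrier_vec n. \<forall>j < n div 4.
             v $ (j + 3 * n div 4) = - v $ j - v $ (j + n div 4) - v $ (j + n div 2)}"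
    proof -
      have sum4: "(\<Sum>k<4. f k) = f 0 + f 1 + f 2 + f 3" for f :: "nat \<Rightarrow> real"
        by (simp add: eval_nat_numeral)
      have "(\<Sum>k<4. v $ (j + k * (2 * r))) = 0 \<longleftrightarrow>
          v $ (j + 6 * r) = - v $ j - v $ (j + 2 * r) - v $ (j + 4 * r)" for v :: "real vec" and j
      proof -
        have "0 * (2 * r) = 0" "1 * (2 * r) = 2 * r" "2 * (2 * r) = 4 * r" "3 * (2 * r) = 6 * r"
          by simp_all
        then show ?thesis unfolding sum4 by (simp only: add_0_right) linarith
      qed
      then show ?thesis unfolding div null_space_three_quarters[OF r r0] by simp
    qed
  }
qed

end
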